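(* Let $|q|<1$ and $x\in\mathbb{C}^*$ such that all quantities below are defined. Then \[ x\,j\bigl(xq;q^2\bigr)g_{3,c}\bigl(x,q^2\bigr)+x^{-1}q\,j\bigl(x;q^2\bigr)g_{3,c}\bigl(xq,q^2\bigr)=\frac{J_1^5}{J_2^2\,j(x;q)}-\frac{J_2\,j(x;q)}{J_1}. \]
   Context: For $n\in\mathbb{Z}\cup\{\infty\}$: $(a;q)_\infty=\prod_{j\ge0}(1-aq^j)$, $(a;q)_n=(a;q)_\infty/(aq^n;q)_\infty$ (also for negative $n$), $(a_1,\dots,a_m;q)_n=\prod_i(a_i;q)_n$. $j(z;q)=(z,q/z,q;q)_\infty$, $J_m=(q^m;q^m)_\infty$. $g_{3,c}(x,q)=\sum_{n=-\infty}^{\infty}\frac{q^{n^2+n}}{(x,q/x;q)_{n+1}}$. *)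

theory Defs
  imports "HOL-Analysis.Analysis"
begin

definition qpoch_inf :: "complex \<Rightarrow> complex \<Rightarrow> complex" where
  "qpoch_inf a q = (\<Prod>j. 1 - a * q ^ j)"

text \<open>
  The denominator vanishes only if \<open>a\<close> is an integral power of \<open>q\<close> (for \<open>0 < \<bar>q\<bar> < 1\<close>). For
  other \<open>a\<close> and negative \<open>n\<close> this is \<open>1 / ((1 - a q\<^sup>-\<^sup>1) \<cdots> (1 - a q\<^sup>n))\<close>.
\<close>
definition qpoch :: "complex \<Rightarrow> complex \<Rightarrow> int \<Rightarrow> complex" where
  "qpoch a q n = qpoch_inf a q / qpoch_inf (a * q powi n) q"

definition theta_j :: "complex \<Rightarrow> complex \<Rightarrow> complex" where
  "theta_j z q = qpoch_inf z q * qpoch_inf (q / z) q * qpoch_inf q q"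

definition J :: "nat \<Rightarrow> complex \<Rightarrow> complex" where
  "J m q = qpoch_inf (q ^ m) (q ^ m)"

text \<open>
  The bilateral series is read as an unconditional (in \<open>\<complex>\<close>: absolute) sum over all integers. For
  \<open>0 < \<bar>q\<bar> < 1\<close> and \<open>x \<notin> {q\<^sup>k | k \<in> \<int>} \<union> {0}\<close> it converges absolutely: the terms decay like
  \<open>q\<^bsup>n\<^sup>2+n\<^esup>\<close> as \<open>n \<rightarrow> \<infinity>\<close> and geometrically, like \<open>\<bar>q\<bar>\<^bsup>\<bar>n\<bar>\<^esup>\<close>, as \<open>n \<rightarrow> -\<infinity>\<close>.
\<close>
definition g3c :: "complex \<Rightarrow> complex \<Rightarrow> complex" where
  "g3c x q = (\<Sum>\<^sub>\<infinity>n\<in>UNIV. q powi (n ^ 2 + n) / (qpoch x q (n + 1) * qpoch (q / x) q (n + 1)))"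

lemma qpoch_inf_eq_0_iff:
  assumes "norm q < 1"
  shows "qpoch_inf a q = 0 \<longleftrightarrow> (\<exists>j. a * q ^ j = 1)"
proof -
  have "summable (\<lambda>j. norm ((1 - a * q ^ j) - 1))"
    using assms by (auto simp: norm_mult norm_power intro!: summable_mult summable_geometric)
  hence "convergent_prod (\<lambda>j. 1 - a * q ^ j)"
    by (intro abs_convergent_prod_imp_convergent_prod summable_imp_abs_convergent_prod)
  hence "(\<lambda>j. 1 - a * q ^ j) has_prod qpoch_inf a q"
    unfolding qpoch_inf_def by (simp add: convergent_prod_has_prod_iff)
  from has_prod_eq_0_iff[OF this] show ?thesis
    by (auto simp: image_iff eq_commute[of 0] eq_commute[of 1])
qed

text \<open>The zeros of \<open>j(z; q)\<close> are exactly the integral powers of \<open>q\<close>.\<close>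

lemma theta_j_eq_0_iff:
  assumes "q \<noteq> 0" "norm q < 1" "z \<noteq> 0"
  shows "theta_j z q = 0 \<longleftrightarrow> (\<exists>k::int. z = q powi k)"
proof -
  have "q * q ^ j \<noteq> 1" for j
  proof
    assume "q * q ^ j = 1"
    hence "norm q ^ Suc j = 1"
      by (metis norm_one norm_power power_Suc)
    thus False
      using assms(2) power_Suc_less_one[of "norm q" j] assms(1) by simp
  qed
  hence "theta_j z q = 0 \<longleftrightarrow> (\<exists>j. z * q ^ j = 1) \<or> (\<exists>j. q / z * q ^ j = 1)"
    using assms by (simp add: theta_j_def qpoch_inf_eq_0_iff)
  also have "(\<exists>j. z * q ^ j = 1) \<longleftrightarrow> (\<exists>j::nat. z = q powi (- int j))"
    using assms by (simp add: power_int_minus field_simps)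
  also have "(\<exists>j. q / z * q ^ j = 1) \<longleftrightarrow> (\<exists>j::nat. z = q powi (int (Suc j)))"
    using assms by (auto simp: power_int_of_nat field_simps simp del: of_nat_Suc)
  also have "(\<exists>j::nat. z = q powi (- int j)) \<or> (\<exists>j::nat. z = q powi (int (Suc j)))
               \<longleftrightarrow> (\<exists>k::int. z = q powi k)"
  proof
    assume "\<exists>k::int. z = q powi k"
    then obtain k :: int where k: "z = q powi k" by blast
    show "(\<exists>j::nat. z = q powi (- int j)) \<or> (\<exists>j::nat. z = q powi (int (Suc j)))"
    proof (cases "k \<le> 0")
      case True
      hence "k = - int (nat (- k))" by simp
      thus ?thesis using k by metis
    next
      case False
      hence "k = int (Suc (nat (k - 1)))" by simp
      thus ?thesis using k by metis
    qed
  qed blast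
  finally show ?thesis .
qed

end

theory Submission
  imports Defs "HOL-Complex_Analysis.Cauchy_Integral_Formula"
begin

text \<open>
  Put \<open>H(x) = (x, q/x; q)\<^sub>\<infinity> g\<^sub>3\<^sub>,\<^sub>c(x, q)\<close>. This is holomorphic on the punctured plane, and telescoping
  gives \<open>H(xq) = x\<^sup>2 H(x) + (x - 1/x) (x, q/x; q)\<^sub>\<infinity>\<^sup>2\<close>. With \<open>q\<^sup>2\<close> in place of \<open>q\<close>, the
  theorem multiplied by \<open>j(x; q\<^sup>2) j(xq; q\<^sup>2) / J\<^sub>2\<close> says that
  \<open>x j(xq; q\<^sup>2)\<^sup>2 H(x) + x\<^sup>-\<^sup>1 q j(x; q\<^sup>2)\<^sup>2 H(xq) + j(x; q\<^sup>2)\<^sup>2 j(xq; q\<^sup>2)\<^sup>2 / J\<^sub>2\<^sup>2\<close>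
  is the constant \<open>J\<^sub>1\<^sup>4 / J\<^sub>2\<close>. The functional equation makes this expression invariant under
  \<open>x \<mapsto> xq\<close>, so it is constant by Liouville's theorem, and at \<open>x = 1\<close> only \<open>H(1) = J\<^sub>2\<close>, a case of
  Cauchy's identity, is needed.
\<close>

section \<open>Preliminaries: finite q-products, holomorphic series, the numerator\<close>

definition qpoch_fin :: "complex \<Rightarrow> complex \<Rightarrow> nat \<Rightarrow> complex" where
  "qpoch_fin a q k = (\<Prod>j<k. 1 - a * q ^ j)"

lemma qpoch_fin_0 [simp]: "qpoch_fin a q 0 = 1"
  by (simp add: qpoch_fin_def)

lemma qpoch_fin_Suc: "qpoch_fin a q (Suc k) = qpoch_fin a q k * (1 - a * q ^ k)"
  by (simp add: qpoch_fin_def)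

lemma qpoch_fin_add: "qpoch_fin a q (n + k) = qpoch_fin a q k * qpoch_fin (a * q ^ k) q n"
  by (induction n) (simp_all add: qpoch_fin_Suc power_add mult_ac)

lemma qpoch_fin_Suc': "qpoch_fin a q (Suc k) = (1 - a) * qpoch_fin (a * q) q k"
  using qpoch_fin_add[of a q k 1] by (simp add: qpoch_fin_Suc)

lemma qpoch_fin_double:
  "qpoch_fin a q (2 * k) = qpoch_fin a (q ^ 2) k * qpoch_fin (a * q) (q ^ 2) k"
  by (induction k) (simp_all add: qpoch_fin_Suc power_mult [symmetric] mult_ac)

lemma holomorphic_qpoch_fin [holomorphic_intros]:
  "f holomorphic_on A \<Longrightarrow> (\<lambda>z. qpoch_fin (f z) q k) holomorphic_on A"
  unfolding qpoch_fin_def by (intro holomorphic_intros)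

text \<open>Dominating the terms on a closed ball about each point gives locally uniform convergence
  of the partial sums. The majorant may vary with the ball, as it must near a puncture.\<close>

lemma holomorphic_suminf:
  fixes f :: "nat \<Rightarrow> complex \<Rightarrow> complex"
  assumes "open S" "\<And>n. f n holomorphic_on S"
    and bound: "\<And>z. z \<in> S \<Longrightarrow> \<exists>d M. 0 < d \<and> cball z d \<subseteq> S \<and> summable M \<and>
                  (\<forall>n. \<forall>w\<in>cball z d. norm (f n w) \<le> M n)"
  shows "(\<lambda>z. \<Sum>n. f n z) holomorphic_on S"
proof (rule holomorphic_uniform_sequence[OF \<open>open S\<close>])
  show "(\<lambda>z. \<Sum>n<N. f n z) holomorphic_on S" for N
    by (intro holomorphic_intros assms)
  fix z assume "z \<in> S"
  from bound[OF this] obtain d M where d: "0 < d" "cball z d \<subseteq> S" "summable M"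
    "\<And>n w. w \<in> cball z d \<Longrightarrow> norm (f n w) \<le> M n" by blast
  have "uniform_limit (cball z d) (\<lambda>N w. \<Sum>n<N. f n w) (\<lambda>w. \<Sum>n. f n w) sequentially"
    by (rule Weierstrass_m_test) (use d in auto)
  with d show "\<exists>d>0. cball z d \<subseteq> S \<and>
      uniform_limit (cball z d) (\<lambda>N w. \<Sum>n<N. f n w) (\<lambda>w. \<Sum>n. f n w) sequentially"
    by blast
qed

text \<open>
  The numerator \<open>H\<close>: the summands of \<open>g\<^sub>3\<^sub>,\<^sub>c\<close> at \<open>n \<ge> 0\<close> and at \<open>n = - k - 1 < 0\<close>, multiplied by
  \<open>(x, q/x; q)\<^sub>\<infinity>\<close>; it makes sense for all \<open>x \<noteq> 0\<close>.
\<close>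
definition g3c_num :: "complex \<Rightarrow> complex \<Rightarrow> complex" where
  "g3c_num x q =
     (\<Sum>n. q ^ (n ^ 2 + n) * qpoch_inf (x * q ^ Suc n) q * qpoch_inf (q ^ (n + 2) / x) q) +
     qpoch_inf x q * qpoch_inf (q / x) q * (\<Sum>k. q ^ k * qpoch_fin x q k * qpoch_fin (q / x) q k)"

section \<open>Infinite q-products: splitting, bounds, holomorphy\<close>

context
  fixes q :: complex
  assumes q: "norm q < 1"
begin

lemma tendsto_qpoch_fin: "qpoch_fin a q \<longlonglongrightarrow> qpoch_inf a q"
proof -
  have "summable (\<lambda>j. norm ((1 - a * q ^ j) - 1))"
    using q by (auto simp: norm_mult norm_power intro!: summable_mult summable_geometric)
  hence "convergent_prod (\<lambda>j. 1 - a * q ^ j)"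
    by (intro abs_convergent_prod_imp_convergent_prod summable_imp_abs_convergent_prod)
  hence "(\<lambda>j. 1 - a * q ^ j) has_prod qpoch_inf a q"
    unfolding qpoch_inf_def by (simp add: convergent_prod_has_prod_iff)
  from has_prod_imp_tendsto'[OF this] show ?thesis
    by (simp add: qpoch_fin_def [abs_def])
qed

lemma qpoch_inf_split: "qpoch_inf a q = qpoch_fin a q k * qpoch_inf (a * q ^ k) q"
proof (rule LIMSEQ_unique)
  show "(\<lambda>n. qpoch_fin a q (n + k)) \<longlonglongrightarrow> qpoch_inf a q"
    by (rule LIMSEQ_ignore_initial_segment[OF tendsto_qpoch_fin])
  show "(\<lambda>n. qpoch_fin a q (n + k)) \<longlonglongrightarrow> qpoch_fin a q k * qpoch_inf (a * q ^ k) q"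
    unfolding qpoch_fin_add by (intro tendsto_intros tendsto_qpoch_fin)
qed

lemma qpoch_inf_head: "qpoch_inf a q = (1 - a) * qpoch_inf (a * q) q"
  using qpoch_inf_split[of a 1] by (simp add: qpoch_fin_Suc)

lemma qpoch_inf_1 [simp]: "qpoch_inf 1 q = 0"
  by (subst qpoch_inf_head) simp

lemma qpoch_inf_0 [simp]: "qpoch_inf 0 q = 1"
  by (simp add: qpoch_inf_def)

lemma qpoch_inf_self_nonzero: "qpoch_inf q q \<noteq> 0"
proof
  assume "qpoch_inf q q = 0"
  then obtain j where "q * q ^ j = 1"
    using qpoch_inf_eq_0_iff[OF q] by blast
  hence "norm q ^ Suc j = 1"
    by (metis norm_one norm_power power_Suc)
  thus False
    using q power_Suc_less_one[of "norm q" j] by (cases "q = 0") auto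
qed

text \<open>By \<open>1 + t \<le> exp t\<close> the product is at most the exponential of a
  geometric series. The bound does not depend on \<open>k\<close>, so it passes to the infinite
  product and serves as a constant in majorants.\<close>

lemma norm_qpoch_fin_le:
  assumes "norm a \<le> R"
  shows "norm (qpoch_fin a q k) \<le> exp (R / (1 - norm q))"
proof -
  have "norm (qpoch_fin a q k) \<le> (\<Prod>j<k. 1 + norm (a * q ^ j))"
    unfolding qpoch_fin_def prod_norm [symmetric]
    by (intro prod_mono conjI norm_ge_zero order_trans[OF norm_triangle_ineq4]) simp
  also have "\<dots> \<le> exp (\<Sum>j<k. norm (a * q ^ j))"
    by (rule prod_le_exp_sum) simp
  also have "(\<Sum>j<k. norm (a * q ^ j)) \<le> (\<Sum>j. norm a * norm q ^ j)"
    unfolding norm_mult norm_power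
    by (rule sum_le_suminf) (use q in \<open>auto intro!: summable_mult summable_geometric\<close>)
  also have "\<dots> = norm a / (1 - norm q)"
    using q by (simp add: suminf_mult suminf_geometric summable_geometric)
  also have "\<dots> \<le> R / (1 - norm q)"
    using q assms by (intro divide_right_mono) auto
  finally show ?thesis by simp
qed

lemma norm_qpoch_inf_le:
  assumes "norm a \<le> R"
  shows "norm (qpoch_inf a q) \<le> exp (R / (1 - norm q))"
  using norm_qpoch_fin_le[OF assms]
  by (intro LIMSEQ_le_const2[OF tendsto_norm[OF tendsto_qpoch_fin]]) auto

lemma holomorphic_qpoch_inf_UNIV: "(\<lambda>z. qpoch_inf z q) holomorphic_on UNIV"
proof (rule holomorphic_uniform_sequence)
  show "(\<lambda>z. qpoch_fin z q n) holomorphic_on UNIV" for n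
    by (intro holomorphic_intros)
  fix z :: complex
  \<comment> \<open>Uniform convergence of the series of \<open>norm (w * q ^ n)\<close> carries
    over to the product; on the unit ball about \<open>z\<close> it has the majorant
    \<open>(norm z + 1) * norm q ^ n\<close>.\<close>
  have "uniformly_convergent_on (cball z 1) (\<lambda>N w. \<Prod>n<N. 1 - w * q ^ n)"
  proof (rule uniformly_convergent_on_prod')
    have "norm w \<le> norm z + 1" if "w \<in> cball z 1" for w
      using that norm_triangle_ineq2[of w z] by (auto simp: dist_norm norm_minus_commute)
    thus "uniformly_convergent_on (cball z 1) (\<lambda>N w. \<Sum>n<N. norm (1 - w * q ^ n - 1))"
      using q
      by (intro Weierstrass_m_test'[where M = "\<lambda>n. (norm z + 1) * norm q ^ n"])
         (auto simp: norm_mult norm_power intro!: mult_right_mono summable_mult summable_geometric)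
  qed (auto intro!: continuous_intros)
  moreover have "lim (\<lambda>N. \<Prod>n<N. 1 - w * q ^ n) = qpoch_inf w q" for w
    using tendsto_qpoch_fin[of w] by (simp add: limI qpoch_fin_def [abs_def])
  ultimately have "uniform_limit (cball z 1) (\<lambda>N w. qpoch_fin w q N) (\<lambda>w. qpoch_inf w q) sequentially"
    by (simp add: uniformly_convergent_uniform_limit_iff qpoch_fin_def)
  thus "\<exists>d>0. cball z d \<subseteq> UNIV \<and>
          uniform_limit (cball z d) (\<lambda>N w. qpoch_fin w q N) (\<lambda>w. qpoch_inf w q) sequentially"
    by (intro exI[of _ 1]) auto
qed auto

lemma holomorphic_qpoch_inf:
  "f holomorphic_on A \<Longrightarrow> (\<lambda>z. qpoch_inf (f z) q) holomorphic_on A"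
  using holomorphic_on_compose_gen[OF _ holomorphic_qpoch_inf_UNIV, of f A] by (simp add: o_def)

lemma continuous_qpoch_inf: "isCont (\<lambda>z. qpoch_inf z q) a"
  using holomorphic_qpoch_inf_UNIV holomorphic_on_imp_continuous_on continuous_on_eq_continuous_at
  by blast

section \<open>Majorants and holomorphy of the numerator\<close>

lemma norm_power_mult_le: "norm (x * q ^ n) \<le> norm x"
  using q by (simp add: norm_mult norm_power mult_left_le power_le_one)

text \<open>Weakening \<open>q ^ (n ^ 2 + n)\<close> to \<open>norm q ^ n\<close> loses nothing
  needed and gives both halves of the numerator the same geometric majorant. Bounding
  \<open>x\<close> and \<open>1 / x\<close> together makes it locally uniform on the punctured
  plane.\<close>

lemma norm_pos_term_le:
  assumes "norm x \<le> R" "norm (1 / x) \<le> R"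
  shows "norm (q ^ (n ^ 2 + n) * qpoch_inf (x * q ^ Suc n) q * qpoch_inf (q ^ (n + 2) / x) q)
           \<le> norm q ^ n * exp (R / (1 - norm q)) ^ 2"
proof -
  have "norm (q ^ (n ^ 2 + n)) \<le> norm q ^ n"
    using q by (auto simp: norm_power intro!: power_decreasing)
  moreover have "norm (qpoch_inf (x * q ^ Suc n) q) \<le> exp (R / (1 - norm q))"
    by (rule norm_qpoch_inf_le) (use norm_power_mult_le[of x "Suc n"] assms in linarith)
  moreover have "norm (qpoch_inf (q ^ (n + 2) / x) q) \<le> exp (R / (1 - norm q))"
    by (rule norm_qpoch_inf_le) (use norm_power_mult_le[of "1 / x" "n + 2"] assms in simp)
  ultimately show ?thesis
    unfolding norm_mult power2_eq_square mult.assoc [symmetric] by (intro mult_mono) auto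
qed

lemma norm_neg_term_le:
  assumes "norm x \<le> R" "norm (1 / x) \<le> R"
  shows "norm (q ^ k * qpoch_fin x q k * qpoch_fin (q / x) q k)
           \<le> norm q ^ k * exp (R / (1 - norm q)) ^ 2"
proof -
  have "norm (qpoch_fin x q k) \<le> exp (R / (1 - norm q))"
    by (rule norm_qpoch_fin_le) (use assms in simp)
  moreover have "norm (qpoch_fin (q / x) q k) \<le> exp (R / (1 - norm q))"
    by (rule norm_qpoch_fin_le) (use norm_power_mult_le[of "1 / x" 1] assms in simp)
  ultimately show ?thesis
    unfolding norm_mult power2_eq_square norm_power mult.assoc [symmetric]
    by (intro mult_mono) auto
qed

lemma summable_bound: "summable (\<lambda>n. norm q ^ n * C)" for C :: real
  using q by (intro summable_mult2 summable_geometric) simp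

lemma summable_norm_pos_terms:
  "summable (\<lambda>n. norm (q ^ (n ^ 2 + n) * qpoch_inf (x * q ^ Suc n) q * qpoch_inf (q ^ (n + 2) / x) q))"
  by (rule summable_comparison_test'[OF summable_bound, of 0])
     (use norm_pos_term_le[of x "max (norm x) (norm (1 / x))"] in auto)

lemma summable_norm_neg_terms:
  "summable (\<lambda>k. norm (q ^ k * qpoch_fin x q k * qpoch_fin (q / x) q k))"
  by (rule summable_comparison_test'[OF summable_bound, of 0])
     (use norm_neg_term_le[of x "max (norm x) (norm (1 / x))"] in auto)

lemma holomorphic_g3c_num: "(\<lambda>x. g3c_num x q) holomorphic_on - {0}"
proof -
  have nbhd: "\<exists>d R. 0 < d \<and> cball z d \<subseteq> - {0} \<and> (\<forall>w\<in>cball z d. norm w \<le> R \<and> norm (1 / w) \<le> R)"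
    if "z \<in> - {0}" for z :: complex
  proof (intro exI conjI ballI)
    have z: "norm z > 0" using that by simp
    thus "0 < norm z / 2" by simp
    have w: "norm w \<ge> norm z / 2 \<and> norm w \<le> 2 * norm z" if "w \<in> cball z (norm z / 2)" for w
      using that norm_triangle_ineq2[of z w] norm_triangle_ineq2[of w z]
      by (auto simp: dist_norm norm_minus_commute)
    thus "cball z (norm z / 2) \<subseteq> - {0}" using z by force
    fix w assume "w \<in> cball z (norm z / 2)"
    note w = w[OF this]
    show "norm w \<le> max (2 * norm z) (2 / norm z)"
      using w by (intro max.coboundedI1) simp
    have "norm (1 / w) \<le> 1 / (norm z / 2)"
      using w z unfolding norm_divide norm_one by (intro divide_left_mono mult_pos_pos) auto
    thus "norm (1 / w) \<le> max (2 * norm z) (2 / norm z)" by simp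
  qed
  have "(\<lambda>x. \<Sum>n. q ^ (n ^ 2 + n) * qpoch_inf (x * q ^ Suc n) q * qpoch_inf (q ^ (n + 2) / x) q)
          holomorphic_on - {0}"
  proof (rule holomorphic_suminf)
    fix z :: complex assume "z \<in> - {0}"
    from nbhd[OF this] obtain d R where
      "0 < d" "cball z d \<subseteq> - {0}" "\<forall>w\<in>cball z d. norm w \<le> R \<and> norm (1 / w) \<le> R" by blast
    thus "\<exists>d M. 0 < d \<and> cball z d \<subseteq> - {0} \<and> summable M \<and> (\<forall>n. \<forall>w\<in>cball z d.
            norm (q ^ (n ^ 2 + n) * qpoch_inf (w * q ^ Suc n) q * qpoch_inf (q ^ (n + 2) / w) q) \<le> M n)"
      using norm_pos_term_le summable_bound by meson
  qed (auto intro!: holomorphic_intros holomorphic_qpoch_inf)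
  moreover have "(\<lambda>x. \<Sum>k. q ^ k * qpoch_fin x q k * qpoch_fin (q / x) q k) holomorphic_on - {0}"
  proof (rule holomorphic_suminf)
    fix z :: complex assume "z \<in> - {0}"
    from nbhd[OF this] obtain d R where
      "0 < d" "cball z d \<subseteq> - {0}" "\<forall>w\<in>cball z d. norm w \<le> R \<and> norm (1 / w) \<le> R" by blast
    thus "\<exists>d M. 0 < d \<and> cball z d \<subseteq> - {0} \<and> summable M \<and> (\<forall>k. \<forall>w\<in>cball z d.
            norm (q ^ k * qpoch_fin w q k * qpoch_fin (q / w) q k) \<le> M k)"
      using norm_neg_term_le summable_bound by meson
  qed (auto intro!: holomorphic_intros)
  ultimately show ?thesis
    unfolding g3c_num_def by (auto intro!: holomorphic_intros holomorphic_qpoch_inf)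
qed

section \<open>The functional equation of the numerator\<close>

text \<open>
  The summands of \<open>H(xq) - x\<^sup>2 H(x)\<close> are \<open>1 - x\<^sup>2\<close> times the differences of the bilateral sequence
  \<open>q\<^bsup>n\<^sup>2+n\<^esup> (x q\<^bsup>n+1\<^esup>; q)\<^sub>\<infinity> (q\<^bsup>n+1\<^esup> / x; q)\<^sub>\<infinity>\<close>, which tends to \<open>0\<close> at \<open>\<infinity>\<close> and to a theta
  product at \<open>-\<infinity>\<close>.
\<close>
lemma g3c_num_shift:
  assumes "q \<noteq> 0" "x \<noteq> 0"
  shows "g3c_num (x * q) q =
           x ^ 2 * g3c_num x q + (x - 1 / x) * (qpoch_inf x q * qpoch_inf (q / x) q) ^ 2"
proof -
  \<comment> \<open>With \<open>y\<close> as a second variable the later identities are polynomial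
    and hold modulo \<open>x * y = 1\<close>.\<close>
  define y where "y = 1 / x"
  have xy: "x * y = 1" and qx: "q / x = y * q" and qxq: "q / (x * q) = y"
    and qnx: "q ^ n / x = y * q ^ n" for n
    using assms by (auto simp: y_def)
  define P where "P = qpoch_inf (x * q) q * qpoch_inf (y * q) q"
  define s where "s = (\<lambda>x n. q ^ (n ^ 2 + n) * qpoch_inf (x * q ^ Suc n) q * qpoch_inf (q ^ (n + 2) / x) q)"
  define t where "t = (\<lambda>x k. q ^ k * qpoch_fin x q k * qpoch_fin (q / x) q k)"
  have s: "s x sums suminf (s x)" for x
    unfolding s_def by (intro summable_sums summable_norm_cancel[OF summable_norm_pos_terms])
  have t: "t x sums suminf (t x)" for x
    unfolding t_def by (intro summable_sums summable_norm_cancel[OF summable_norm_neg_terms])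
  \<comment> \<open>\<open>V n\<close> is the bilateral sequence at \<open>n\<close>, and
    \<open>W k\<close> is its value at \<open>- k\<close>, with the products reflected so that no
    negative powers of \<open>q\<close> remain.\<close>
  define V where "V = (\<lambda>n. q ^ (n ^ 2 + n) * qpoch_inf (x * q ^ Suc n) q * qpoch_inf (y * q ^ Suc n) q)"
  define W where "W = (\<lambda>k. P * (qpoch_fin x q k * qpoch_fin y q k))"
  have "V \<longlonglongrightarrow> 0"
  proof -
    define R where "R = exp (max (norm x) (norm y) / (1 - norm q)) ^ 2"
    have "norm (V n) \<le> norm q ^ n * R" for n
    proof -
      have "norm (q ^ (n ^ 2 + n)) \<le> norm q ^ n"
        using q by (auto simp: norm_power intro!: power_decreasing)
      moreover have "norm (qpoch_inf (z * q ^ Suc n) q) \<le> exp (max (norm x) (norm y) / (1 - norm q))"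
        if "z = x \<or> z = y" for z
        by (rule norm_qpoch_inf_le) (use norm_power_mult_le[of z "Suc n"] that in auto)
      ultimately show ?thesis
        unfolding V_def R_def norm_mult power2_eq_square mult.assoc [symmetric]
        by (intro mult_mono) auto
    qed
    moreover have "(\<lambda>n. norm q ^ n * R) \<longlonglongrightarrow> 0"
      using q by (intro tendsto_mult_left_zero LIMSEQ_power_zero) auto
    ultimately show ?thesis by (intro Lim_null_comparison[of V]) auto
  qed
  have V_step: "s (x * q) n - x ^ 2 * s x n = (1 - x ^ 2) * (V n - V (Suc n))" for n
  proof -
    define A where "A = qpoch_inf (x * q ^ (n + 2)) q"
    define B where "B = qpoch_inf (y * q ^ (n + 2)) q"
    define r where "r = q ^ Suc n"
    have A: "qpoch_inf (x * q ^ Suc n) q = (1 - x * r) * A"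
      and B: "qpoch_inf (y * q ^ Suc n) q = (1 - y * r) * B"
      unfolding A_def B_def r_def by (subst qpoch_inf_head, simp add: mult_ac)+
    have "q ^ (Suc n ^ 2 + Suc n) = q ^ (n ^ 2 + n) * r ^ 2"
      unfolding r_def by (simp add: power_mult [symmetric] power_add [symmetric] power2_eq_square algebra_simps)
    hence V1: "V (Suc n) = q ^ (n ^ 2 + n) * r ^ 2 * A * B"
      unfolding V_def A_def B_def by simp
    have V0: "V n = q ^ (n ^ 2 + n) * ((1 - x * r) * A) * ((1 - y * r) * B)"
      unfolding V_def A B ..
    have s0: "s x n = q ^ (n ^ 2 + n) * ((1 - x * r) * A) * B"
      unfolding s_def A B_def qnx ..
    have "x * q * q ^ Suc n = x * q ^ (n + 2)" "q ^ (n + 2) / (x * q) = y * q ^ Suc n"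
      using assms by (auto simp: y_def)
    hence s1: "s (x * q) n = q ^ (n ^ 2 + n) * A * ((1 - y * r) * B)"
      unfolding s_def B [symmetric] A_def by (simp only:)
    have "c * A * ((1 - y * r) * B) - x ^ 2 * (c * ((1 - x * r) * A) * B)
            = (1 - x ^ 2) * (c * ((1 - x * r) * A) * ((1 - y * r) * B) - c * r ^ 2 * A * B)" for c
      using xy by algebra
    thus ?thesis unfolding s0 s1 V0 V1 .
  qed
  have "(\<lambda>n. s (x * q) n - x ^ 2 * s x n) sums ((1 - x ^ 2) * (V 0 - 0))"
    unfolding V_step by (intro sums_mult telescope_sums' \<open>V \<longlonglongrightarrow> 0\<close>)
  hence S: "suminf (s (x * q)) - x ^ 2 * suminf (s x) = (1 - x ^ 2) * P"
    using sums_unique2[OF sums_diff[OF s sums_mult[OF s]]] by (simp add: V_def P_def)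
  have Qx: "qpoch_inf x q = (1 - x) * qpoch_inf (x * q) q"
    and Qy: "qpoch_inf y q = (1 - y) * qpoch_inf (y * q) q"
    by (rule qpoch_inf_head)+
  have W_step: "qpoch_inf (x * q) q * qpoch_inf y q * t (x * q) k
                 - x ^ 2 * (qpoch_inf x q * qpoch_inf (y * q) q) * t x k
                 = (1 - x ^ 2) * (W (Suc k) - W k)" for k
  proof -
    define X where "X = qpoch_fin x q k"
    define Y where "Y = qpoch_fin y q k"
    define r where "r = q ^ k"
    have X: "(1 - x) * qpoch_fin (x * q) q k = X * (1 - x * r)"
      and Y: "(1 - y) * qpoch_fin (y * q) q k = Y * (1 - y * r)"
      unfolding X_def Y_def r_def using qpoch_fin_Suc' qpoch_fin_Suc by metis+
    have W: "W k = P * (X * Y)" "W (Suc k) = P * (X * (1 - x * r) * (Y * (1 - y * r)))"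
      unfolding W_def X_def Y_def r_def qpoch_fin_Suc by auto
    have t0: "t x k = r * X * qpoch_fin (y * q) q k"
      unfolding t_def X_def r_def qx ..
    have t1: "t (x * q) k = r * qpoch_fin (x * q) q k * Y"
      unfolding t_def Y_def r_def qxq ..
    \<comment> \<open>From \<open>x * y = 1\<close> follow \<open>1 - y = - y * (1 - x)\<close> and
      \<open>1 - x = - x * (1 - y)\<close>. This yields the factors that complete the shifted finite
      products to \<open>X * (1 - x * r)\<close> and \<open>Y * (1 - y * r)\<close>.\<close>
    have "qpoch_inf (x * q) q * qpoch_inf y q * t (x * q) k
                 - x ^ 2 * (qpoch_inf x q * qpoch_inf (y * q) q) * t x k
          = P * r * (- y * ((1 - x) * qpoch_fin (x * q) q k) * Y
                 + x ^ 3 * X * ((1 - y) * qpoch_fin (y * q) q k))"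
      unfolding t0 t1 Qx Qy P_def using xy by algebra
    also have "\<dots> = (1 - x ^ 2) * (W (Suc k) - W k)"
      unfolding X Y W using xy by algebra
    finally show ?thesis .
  qed
  have "W \<longlonglongrightarrow> P * (qpoch_inf x q * qpoch_inf y q)"
    unfolding W_def by (intro tendsto_intros tendsto_qpoch_fin)
  hence "(\<lambda>k. qpoch_inf (x * q) q * qpoch_inf y q * t (x * q) k
                 - x ^ 2 * (qpoch_inf x q * qpoch_inf (y * q) q) * t x k)
           sums ((1 - x ^ 2) * (P * (qpoch_inf x q * qpoch_inf y q) - W 0))"
    unfolding W_step by (intro sums_mult telescope_sums)
  hence T: "qpoch_inf (x * q) q * qpoch_inf y q * suminf (t (x * q))
             - x ^ 2 * (qpoch_inf x q * qpoch_inf (y * q) q) * suminf (t x)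
             = (1 - x ^ 2) * (P * (qpoch_inf x q * qpoch_inf y q) - P)"
    using sums_unique2[OF sums_diff[OF sums_mult[OF t] sums_mult[OF t]]] by (simp add: W_def)
  have num: "g3c_num x q = suminf (s x) + qpoch_inf x q * qpoch_inf (y * q) q * suminf (t x)"
    "g3c_num (x * q) q = suminf (s (x * q)) + qpoch_inf (x * q) q * qpoch_inf y q * suminf (t (x * q))"
    unfolding g3c_num_def s_def t_def qx qxq by (rule refl)+
  \<comment> \<open>Since \<open>V 0 = W 0 = P\<close>, the boundary terms of the two halves cancel
    and only the limit of \<open>W\<close> remains.\<close>
  have "g3c_num (x * q) q - x ^ 2 * g3c_num x q = (1 - x ^ 2) * P * (qpoch_inf x q * qpoch_inf y q)"
    using S T unfolding num by algebra
  also have "\<dots> = (x - y) * (qpoch_inf x q * qpoch_inf (y * q) q) ^ 2"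
    unfolding Qx Qy P_def using xy by algebra
  finally show ?thesis
    unfolding qx y_def [symmetric] by (simp add: algebra_simps)
qed

section \<open>The value of the numerator at 1\<close>

text \<open>
  This is Cauchy's identity \<open>\<Sum>\<^sub>n q\<^bsup>n\<^sup>2+n\<^esup> / ((q; q)\<^sub>n (q; q)\<^sub>n\<^sub>+\<^sub>1) = 1 / (q; q)\<^sub>\<infinity>\<close>. The sums \<open>u m\<close>
  are the same for all widths \<open>m\<close> of the Durfee rectangle: their differences satisfy
  \<open>d m = - q\<^bsup>m+1\<^esup> d (m + 1)\<close> and tend to \<open>0\<close>.
\<close>
lemma g3c_num_1: "g3c_num 1 q = qpoch_inf q q"
proof -
  \<comment> \<open>The Durfee summand with denominators (q;q)_n and (q;q)_(n+m), multiplied by the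
    square of \<open>qpoch_inf q q\<close>. For \<open>m = 1\<close> these are the terms of the
    first series in \<open>g3c_num 1 q\<close>; the second series has the factor
    \<open>qpoch_inf 1 q = 0\<close>.\<close>
  define t where "t = (\<lambda>m n. q ^ (n ^ 2 + m * n) * qpoch_inf (q ^ Suc n) q * qpoch_inf (q ^ (n + m + 1)) q)"
  define u where "u = (\<lambda>m. \<Sum>n. t m n)"
  define C where "C = exp (1 / (1 - norm q))"
  have C: "norm (qpoch_inf (q ^ n) q) \<le> C" for n
    unfolding C_def by (rule norm_qpoch_inf_le) (use norm_power_mult_le[of 1 n] in simp)
  \<comment> \<open>Only the terms from index 1 on carry a factor \<open>q ^ m\<close>. The term at
    index 0 is kept apart because it alone supplies the limit of \<open>u\<close>.\<close>
  have t_le: "norm (t m (Suc n)) \<le> norm q ^ m * (norm q ^ n * C ^ 2)" for m n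
  proof -
    have "norm (q ^ (Suc n ^ 2 + m * Suc n)) \<le> norm q ^ (m + n)"
      unfolding norm_power using q
      by (intro power_decreasing) (auto simp: power2_eq_square algebra_simps)
    hence "norm (t m (Suc n)) \<le> norm q ^ (m + n) * C * C"
      unfolding t_def norm_mult by (intro mult_mono C) (auto simp: C_def)
    thus ?thesis by (simp add: power_add power2_eq_square mult_ac)
  qed
  have summ: "summable (\<lambda>n. norm q ^ m * (norm q ^ n * C ^ 2))" for m
    by (intro summable_mult summable_bound)
  have "summable (\<lambda>n. t m (Suc n))" for m
    by (rule summable_comparison_test'[OF summ, of 0]) (use t_le in auto)
  hence summable_t: "summable (t m)" for m
    by (subst (asm) summable_Suc_iff)
  have t: "t m sums u m" for m
    unfolding u_def using summable_t by (rule summable_sums)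

  have u_lim: "u \<longlonglongrightarrow> qpoch_inf q q"
  proof -
    have "norm (u m - t m 0) \<le> norm q ^ m * (\<Sum>n. norm q ^ n * C ^ 2)" for m
    proof -
      have "u m - t m 0 = (\<Sum>n. t m (Suc n))"
        unfolding u_def by (simp add: suminf_split_head[OF summable_t])
      also have "norm \<dots> \<le> (\<Sum>n. norm q ^ m * (norm q ^ n * C ^ 2))"
        by (rule norm_suminf_le[OF t_le summ])
      finally show ?thesis by (simp add: suminf_mult summable_bound)
    qed
    moreover have "(\<lambda>m. norm q ^ m * (\<Sum>n. norm q ^ n * C ^ 2)) \<longlonglongrightarrow> 0"
      using q by (intro tendsto_mult_left_zero LIMSEQ_power_zero) auto
    ultimately have "(\<lambda>m. u m - t m 0) \<longlonglongrightarrow> 0"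
      by (intro Lim_null_comparison[of "\<lambda>m. u m - t m 0"]) auto
    moreover have "(\<lambda>m. t m 0) \<longlonglongrightarrow> qpoch_inf q q * qpoch_inf 0 q"
    proof -
      have "(\<lambda>m. q ^ (m + 1)) \<longlonglongrightarrow> 0"
        using q by (intro LIMSEQ_ignore_initial_segment LIMSEQ_power_zero)
      hence "(\<lambda>m. qpoch_inf q q * qpoch_inf (q ^ (m + 1)) q) \<longlonglongrightarrow> qpoch_inf q q * qpoch_inf 0 q"
        by (intro tendsto_mult tendsto_const isCont_tendsto_compose[OF continuous_qpoch_inf])
      thus ?thesis by (simp add: t_def)
    qed
    ultimately show ?thesis
      using tendsto_add by fastforce
  qed

  have rec: "u (Suc m) - u m = - (q ^ Suc m * (u (Suc (Suc m)) - u (Suc m)))" for m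
  proof -
    \<comment> \<open>A telescoping certificate: termwise, the two sides of the recurrence differ by
      \<open>X (Suc n) - X n\<close>. The factor \<open>qpoch_inf (q ^ n) q\<close> makes
      \<open>X 0\<close> vanish, and \<open>X\<close> tends to 0, so the sum is 0.\<close>
    define X where "X = (\<lambda>n. q ^ (n ^ 2 + m * n) * qpoch_inf (q ^ n) q * qpoch_inf (q ^ (n + m + 2)) q)"
    have XSuc: "X (Suc n) = q ^ Suc m * t (Suc (Suc m)) n" for n
    proof -
      have "Suc n ^ 2 + m * Suc n = Suc m + (n ^ 2 + Suc (Suc m) * n)"
        by (simp add: power2_eq_square algebra_simps)
      thus ?thesis unfolding X_def t_def by (simp add: power_add mult_ac)
    qed
    have "t (Suc m) n - t m n - q ^ Suc m * (t (Suc m) n - t (Suc (Suc m)) n) = X (Suc n) - X n" for n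
    proof -
      have 1: "qpoch_inf (q ^ n) q = (1 - q ^ n) * qpoch_inf (q ^ Suc n) q"
        and 2: "qpoch_inf (q ^ (n + m + 1)) q = (1 - q ^ n * q ^ Suc m) * qpoch_inf (q ^ (n + m + 2)) q"
        by (subst qpoch_inf_head, simp add: power_add mult_ac)+
      have 3: "t (Suc m) n = q ^ (n ^ 2 + m * n) * q ^ n * qpoch_inf (q ^ Suc n) q * qpoch_inf (q ^ (n + m + 2)) q"
        unfolding t_def by (simp add: power_add mult_ac)
      have 4: "t m n = q ^ (n ^ 2 + m * n) * qpoch_inf (q ^ Suc n) q *
                  ((1 - q ^ n * q ^ Suc m) * qpoch_inf (q ^ (n + m + 2)) q)"
        unfolding t_def 2 ..
      have 5: "X n = q ^ (n ^ 2 + m * n) * ((1 - q ^ n) * qpoch_inf (q ^ Suc n) q) * qpoch_inf (q ^ (n + m + 2)) q"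
        unfolding X_def 1 ..
      have "c * a * A * B - c * A * ((1 - a * b) * B) - b * (c * a * A * B - T) = b * T - c * ((1 - a) * A) * B"
        for a b c A B T :: complex by algebra
      thus ?thesis unfolding XSuc 3 4 5 .
    qed
    moreover have "(\<lambda>n. t (Suc m) n - t m n - q ^ Suc m * (t (Suc m) n - t (Suc (Suc m)) n))
        sums (u (Suc m) - u m - q ^ Suc m * (u (Suc m) - u (Suc (Suc m))))"
      by (intro sums_diff sums_mult t)
    moreover have "X \<longlonglongrightarrow> 0"
    proof -
      have "(\<lambda>n. X (Suc n)) \<longlonglongrightarrow> 0"
        unfolding XSuc by (intro tendsto_mult_right_zero summable_LIMSEQ_zero summable_t)
      thus ?thesis by (rule LIMSEQ_imp_Suc)
    qed
    from telescope_sums[OF this] have "(\<lambda>n. X (Suc n) - X n) sums 0"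
      by (simp add: X_def)
    ultimately have "u (Suc m) - u m - q ^ Suc m * (u (Suc m) - u (Suc (Suc m))) = 0"
      by (metis (no_types, lifting) sums_cong sums_unique2)
    thus ?thesis by (simp add: algebra_simps)
  qed

  define d where "d = (\<lambda>m. u (Suc m) - u m)"
  have "d \<longlonglongrightarrow> qpoch_inf q q - qpoch_inf q q"
    unfolding d_def by (intro tendsto_diff LIMSEQ_Suc u_lim)
  hence d_lim: "(\<lambda>m. norm (d m)) \<longlonglongrightarrow> 0" by (simp add: tendsto_norm_zero)
  have d_mono: "norm (d m) \<le> norm (d (Suc m))" for m
  proof -
    have "d m = - (d (Suc m) * q ^ Suc m)"
      unfolding d_def using rec[of m] by (simp add: mult_ac)
    thus ?thesis using norm_power_mult_le[of "d (Suc m)" "Suc m"] by simp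
  qed
  \<comment> \<open>The norms of \<open>d\<close> are nondecreasing because \<open>q ^ Suc m\<close>
    has norm at most 1; their limit 0 is then an upper bound.\<close>
  have "d m = 0" for m
    using incseq_le[OF incseq_SucI d_lim, of m] d_mono by simp
  hence "u m = u 0" for m
    by (induction m) (auto simp: d_def)
  hence "u = (\<lambda>_. u 1)" by metis
  hence "u \<longlonglongrightarrow> u 1" by (metis tendsto_const)
  hence "u 1 = qpoch_inf q q" using u_lim LIMSEQ_unique by blast
  thus ?thesis by (simp add: g3c_num_def u_def t_def)
qed

section \<open>The bilateral series as a quotient by the numerator's product\<close>

text \<open>Reflection turns each factor with a negative power of \<open>q\<close> into a monomial
  times a factor of the other product. The powers of \<open>x\<close> cancel, and those of
  \<open>q\<close> reduce \<open>q ^ (k ^ 2 + k)\<close> to \<open>q ^ k\<close>.\<close>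

lemma g3c_neg_term:
  assumes "q \<noteq> 0" "x \<noteq> 0"
  shows "q ^ (k ^ 2 + k) * qpoch_inf (x * q powi - int k) q * qpoch_inf (q / x * q powi - int k) q
           = q ^ k * qpoch_fin x q k * qpoch_fin (q / x) q k * (qpoch_inf x q * qpoch_inf (q / x) q)"
proof (induction k)
  case (Suc k)
  define r where "r = q ^ k"
  have r: "r \<noteq> 0" using assms by (simp add: r_def)
  have pw: "q powi - int (Suc k) = 1 / (r * q)" "q powi - int k = 1 / r"
    by (simp_all add: r_def power_int_minus power_int_add field_simps del: of_nat_Suc)
  have head: "qpoch_inf (a * q powi - int (Suc k)) q = (1 - a / (r * q)) * qpoch_inf (a * q powi - int k) q" for a
    using qpoch_inf_head[of "a / (r * q)"] assms by (simp only: pw) simp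
  have e: "q ^ (Suc k ^ 2 + Suc k) = q ^ (k ^ 2 + k) * (q ^ 2 * r ^ 2)"
    unfolding r_def by (simp add: power_mult [symmetric] power_add [symmetric] power2_eq_square algebra_simps)
  have f: "q ^ 2 * r ^ 2 * (1 - x / (r * q)) * (1 - q / x / (r * q)) = q * (1 - x * r) * (1 - q / x * r)"
    using assms r by (simp add: field_simps power2_eq_square)
  have "q ^ (Suc k ^ 2 + Suc k) * qpoch_inf (x * q powi - int (Suc k)) q * qpoch_inf (q / x * q powi - int (Suc k)) q
      = (q ^ 2 * r ^ 2 * (1 - x / (r * q)) * (1 - q / x / (r * q))) *
        (q ^ (k ^ 2 + k) * qpoch_inf (x * q powi - int k) q * qpoch_inf (q / x * q powi - int k) q)"
    unfolding head e by (simp only: mult_ac)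
  also have "\<dots> = q ^ Suc k * qpoch_fin x q (Suc k) * qpoch_fin (q / x) q (Suc k) * (qpoch_inf x q * qpoch_inf (q / x) q)"
    unfolding f Suc.IH unfolding qpoch_fin_Suc r_def power_Suc by (simp only: mult_ac)
  finally show ?case .
qed simp

lemma g3c_eq:
  assumes "q \<noteq> 0" "x \<noteq> 0" "\<And>k::int. x \<noteq> q powi k"
  shows "g3c x q = g3c_num x q / (qpoch_inf x q * qpoch_inf (q / x) q)"
proof -
  define D where "D = qpoch_inf x q * qpoch_inf (q / x) q"
  have "theta_j x q \<noteq> 0"
    using theta_j_eq_0_iff[OF assms(1) q assms(2)] assms(3) by blast
  hence D: "D \<noteq> 0" "qpoch_inf x q \<noteq> 0" "qpoch_inf (q / x) q \<noteq> 0"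
    by (auto simp: theta_j_def D_def)
  define s where "s = (\<lambda>n. q ^ (n ^ 2 + n) * qpoch_inf (x * q ^ Suc n) q * qpoch_inf (q ^ (n + 2) / x) q)"
  define t where "t = (\<lambda>k. q ^ k * qpoch_fin x q k * qpoch_fin (q / x) q k)"
  define f where "f = (\<lambda>n::int. q powi (n ^ 2 + n) / (qpoch x q (n + 1) * qpoch (q / x) q (n + 1)))"
  have f_pos: "f (int n) = s n / D" for n
  proof -
    have "q powi (int n ^ 2 + int n) = q ^ (n ^ 2 + n)"
      by (metis of_nat_add of_nat_power power_int_of_nat)
    moreover have "q powi (int n + 1) = q ^ Suc n"
      by (metis of_nat_Suc add.commute power_int_of_nat)
    moreover have "q / x * q ^ Suc n = q ^ (n + 2) / x" by simp
    ultimately show ?thesis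
      unfolding f_def qpoch_def s_def D_def by (simp only: divide_divide_eq_right times_divide_times_eq mult_ac)
  qed
  \<comment> \<open>At \<open>n = - k - 1\<close> the exponent \<open>n ^ 2 + n\<close> is
    \<open>k ^ 2 + k\<close> and the lower index \<open>n + 1\<close> is \<open>- k\<close>, so
    reflection applies and \<open>D\<close> cancels.\<close>
  have f_neg: "f (- int k - 1) = t k" for k
  proof -
    have "(- int k - 1) ^ 2 + (- int k - 1) = int (k ^ 2 + k)"
      by (simp add: power2_eq_square algebra_simps)
    hence "q powi ((- int k - 1) ^ 2 + (- int k - 1)) = q ^ (k ^ 2 + k)"
      by (simp only: power_int_of_nat)
    moreover have "- int k - 1 + 1 = - int k" by simp
    ultimately have "f (- int k - 1) = q ^ (k ^ 2 + k) * qpoch_inf (x * q powi - int k) q *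
                       qpoch_inf (q / x * q powi - int k) q / D"
      unfolding f_def qpoch_def D_def by (simp only: divide_divide_eq_right times_divide_times_eq mult_ac)
    also have "\<dots> = t k"
      using D unfolding g3c_neg_term[OF assms(1,2)] t_def D_def by simp
    finally show ?thesis .
  qed
  have "(s has_sum suminf s) UNIV"
    unfolding s_def
    by (intro norm_summable_imp_has_sum summable_sums summable_norm_cancel[OF summable_norm_pos_terms]
          summable_norm_pos_terms)
  hence "((\<lambda>n. s n / D) has_sum suminf s / D) UNIV"
    using has_sum_cmult_left[of s UNIV "suminf s" "1 / D"] by simp
  hence pos: "(f has_sum suminf s / D) (range int)"
    by (subst has_sum_reindex) (simp_all add: f_pos o_def)
  have "(t has_sum suminf t) UNIV"
    unfolding t_def
    by (intro norm_summable_imp_has_sum summable_sums summable_norm_cancel[OF summable_norm_neg_terms]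
          summable_norm_neg_terms)
  hence neg: "(f has_sum suminf t) (range (\<lambda>k. - int k - 1))"
    by (subst has_sum_reindex) (simp_all add: f_neg o_def inj_on_def)
  have "n \<in> range int \<union> range (\<lambda>k. - int k - 1)" for n
  proof (cases "n \<ge> 0")
    case True
    hence "n = int (nat n)" by simp
    thus ?thesis by blast
  next
    case False
    hence "n = - int (nat (- n - 1)) - 1" by simp
    thus ?thesis by blast
  qed
  hence "range int \<union> range (\<lambda>k. - int k - 1) = UNIV" by blast
  moreover have "range int \<inter> range (\<lambda>k. - int k - 1) = {}" by auto
  ultimately have "(f has_sum (suminf s / D + suminf t)) UNIV"
    using has_sum_Un_disjoint[OF pos neg] by simp
  hence "g3c x q = suminf s / D + suminf t"
    unfolding g3c_def f_def by (rule infsumI)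
  also have "\<dots> = g3c_num x q / D"
    using D unfolding g3c_num_def s_def [symmetric] t_def [symmetric] D_def [symmetric]
    by (simp add: add_divide_distrib)
  finally show ?thesis unfolding D_def .
qed

section \<open>Theta functions, change of base, multiplicative periodicity\<close>

text \<open>The first product loses the factor \<open>1 - z\<close> and the second gains
  \<open>1 - 1 / z\<close>, which is \<open>- 1 / z\<close> times the lost one.\<close>

lemma theta_j_shift:
  assumes "q \<noteq> 0" "z \<noteq> 0"
  shows "theta_j (z * q) q = - theta_j z q / z"
proof -
  have 1: "qpoch_inf (1 / z) q = (1 - 1 / z) * qpoch_inf (q / z) q"
    using qpoch_inf_head[of "1 / z"] by simp
  have 2: "q / (z * q) = 1 / z"
    using assms by simp
  show ?thesis
    unfolding theta_j_def 2 1 qpoch_inf_head[of z] using assms by (simp add: field_simps)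
qed

lemma theta_j_1: "theta_j 1 q = 0"
  by (simp add: theta_j_def)

lemma holomorphic_theta_j: "(\<lambda>z. theta_j z q) holomorphic_on - {0}"
  unfolding theta_j_def by (intro holomorphic_intros holomorphic_qpoch_inf) auto

end

text \<open>Even and odd exponents are separated in the finite products of even length, a
  subsequence with the same limit.\<close>

lemma qpoch_inf_double:
  assumes q: "norm q < 1"
  shows "qpoch_inf a q = qpoch_inf a (q ^ 2) * qpoch_inf (a * q) (q ^ 2)"
proof (rule LIMSEQ_unique)
  have "norm (q ^ 2) < 1"
    using q by (simp add: norm_power power_less_one_iff)
  thus "(\<lambda>k. qpoch_fin a q (2 * k)) \<longlonglongrightarrow> qpoch_inf a (q ^ 2) * qpoch_inf (a * q) (q ^ 2)"
    unfolding qpoch_fin_double by (intro tendsto_mult tendsto_qpoch_fin)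
  show "(\<lambda>k. qpoch_fin a q (2 * k)) \<longlonglongrightarrow> qpoch_inf a q"
    using LIMSEQ_subseq_LIMSEQ[OF tendsto_qpoch_fin[OF q], of "\<lambda>k. 2 * k" a]
    by (simp add: o_def strict_mono_def)
qed

text \<open>Periodicity moves every point into a compact annulus, so \<open>E\<close> is bounded.
  Composition with \<open>exp\<close> removes the puncture and gives a bounded entire
  function.\<close>

lemma multiplicatively_periodic_imp_constant:
  fixes q :: complex
  assumes "q \<noteq> 0" and q: "norm q < 1" and holo: "E holomorphic_on - {0}"
    and period: "\<And>z. z \<noteq> 0 \<Longrightarrow> E (z * q) = E z"
    and "x \<noteq> 0"
  shows "E x = E 1"
proof -
  have nat_period: "E (z * q ^ n) = E z" if "z \<noteq> 0" for z n
  proof (induction n)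
    case (Suc n)
    have "E (z * q ^ Suc n) = E (z * q ^ n * q)" by (simp add: mult_ac)
    thus ?case using Suc period[of "z * q ^ n"] that assms(1) by simp
  qed simp
  have int_period: "E (z * q powi k) = E z" if "z \<noteq> 0" for z and k :: int
  proof (cases "k \<ge> 0")
    case True
    thus ?thesis using nat_period[OF that, of "nat k"] by (simp add: power_int_def)
  next
    case False
    have "z * q powi k * q ^ nat (- k) = z"
      using False assms(1) by (simp add: power_int_def field_simps)
    thus ?thesis using nat_period[of "z * q powi k" "nat (- k)"] that assms(1) by (metis mult_eq_0_iff power_int_eq_0_iff)
  qed
  define A where "A = cball 0 1 - ball (0 :: complex) (norm q)"
  have "compact A" unfolding A_def by (intro compact_diff) auto
  moreover have "A \<subseteq> - {0}" using assms(1) by (auto simp: A_def)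
  hence "continuous_on A E"
    using holo holomorphic_on_imp_continuous_on continuous_on_subset by blast
  ultimately have "bounded (E ` A)"
    using compact_continuous_image compact_imp_bounded by blast
  moreover have "E z \<in> E ` A" if "z \<noteq> 0" for z
  proof -
    \<comment> \<open>Dividing by \<open>q powi k\<close> subtracts \<open>k * ln (norm q)\<close>
      from \<open>ln (norm z)\<close>. As \<open>ln (norm q)\<close> is negative, the floor puts the
      result between \<open>ln (norm q)\<close> and 0.\<close>
    define k where "k = \<lfloor>ln (norm z) / ln (norm q)\<rfloor>"
    have lq: "ln (norm q) < 0" using q assms(1) by simp
    have k: "real_of_int k \<le> ln (norm z) / ln (norm q)" "ln (norm z) / ln (norm q) \<le> real_of_int k + 1"
      unfolding k_def by linarith+
    have "norm (z * q powi - k) = norm z * norm q powr real_of_int (- k)"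
      using assms(1) powr_real_of_int'[of "norm q" "- k"] by (simp add: norm_mult norm_power_int)
    also have "\<dots> = exp (ln (norm z) - k * ln (norm q))"
      using that assms(1) by (simp add: powr_def exp_diff exp_minus field_simps)
    finally have nrm: "norm (z * q powi - k) = exp (ln (norm z) - k * ln (norm q))" .
    have "ln (norm z) - k * ln (norm q) \<le> 0" "ln (norm q) \<le> ln (norm z) - k * ln (norm q)"
      using k lq by (auto simp: field_simps)
    hence "norm (z * q powi - k) \<le> 1" "norm q \<le> norm (z * q powi - k)"
      unfolding nrm using assms(1) exp_le_cancel_iff[of "ln (norm q)"] by auto
    hence "z * q powi - k \<in> A" by (auto simp: A_def)
    thus ?thesis using int_period[OF that, of "- k"] by (metis image_eqI)
  qed
  ultimately have "bounded (range (\<lambda>w. E (exp w)))"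
    by (elim bounded_subset) auto
  moreover have "(\<lambda>w. E (exp w)) holomorphic_on UNIV"
    using holomorphic_on_compose_gen[OF holomorphic_on_exp holo, of UNIV]
    by (fastforce simp: o_def)
  ultimately have "(\<lambda>w. E (exp w)) constant_on UNIV"
    by (intro Liouville_theorem)
  hence "E (exp (Ln x)) = E (exp 0)"
    unfolding constant_on_def by (metis UNIV_I)
  thus ?thesis using \<open>x \<noteq> 0\<close> by simp
qed

section \<open>The periodic function in base q^2 and its constant value\<close>

theorem theorem2p6:
  fixes q x :: complex
  assumes "q \<noteq> 0" and "norm q < 1" and "x \<noteq> 0"
    and "\<And>k::int. x \<noteq> q powi k"
  shows "x * theta_j (x * q) (q ^ 2) * g3c x (q ^ 2)
           + inverse x * q * theta_j x (q ^ 2) * g3c (x * q) (q ^ 2)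
         = J 1 q ^ 5 / (J 2 q ^ 2 * theta_j x q) - J 2 q * theta_j x q / J 1 q"
proof -
  define p where "p = q ^ 2"
  have p: "p \<noteq> 0" "norm p < 1"
    using assms by (auto simp: p_def norm_power power_less_one_iff)
  define \<theta> where "\<theta> = (\<lambda>z. theta_j z p)"
  define H where "H = (\<lambda>z. g3c_num z p)"
  define J1 where "J1 = J 1 q"
  define J2 where "J2 = J 2 q"
  have J: "J1 = qpoch_inf q q" "J2 = qpoch_inf p p"
    by (simp_all add: J1_def J2_def J_def p_def)
  have Jnz: "J1 \<noteq> 0" "J2 \<noteq> 0"
    unfolding J using qpoch_inf_self_nonzero assms(2) p(2) by auto
  have prod: "qpoch_inf z p * qpoch_inf (p / z) p = \<theta> z / J2" for z
    using Jnz by (simp add: \<theta>_def theta_j_def J)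
  have J1_eq: "J1 = qpoch_inf q p * J2"
    using qpoch_inf_double[OF assms(2), of q] by (simp add: J p_def power2_eq_square)
  have \<theta>_q: "\<theta> q * J2 = J1 ^ 2"
    unfolding J1_eq using assms(1)
    by (simp add: \<theta>_def theta_j_def J p_def power2_eq_square mult_ac)
  \<comment> \<open>Splitting both products by parity, the even part of \<open>z\<close> pairs with
    the odd part of \<open>q / z\<close> to form \<open>\<theta> z\<close>; the other two parts form
    \<open>\<theta> (z * q)\<close>.\<close>
  have \<theta>_prod: "theta_j z q = J1 / J2 ^ 2 * \<theta> z * \<theta> (z * q)" if "z \<noteq> 0" for z
  proof -
    have "\<theta> z = qpoch_inf z p * qpoch_inf (q / z * q) p * J2"
      by (simp add: \<theta>_def theta_j_def J p_def power2_eq_square)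
    moreover have "\<theta> (z * q) = qpoch_inf (z * q) p * qpoch_inf (q / z) p * J2"
      using assms(1) by (simp add: \<theta>_def theta_j_def J p_def power2_eq_square)
    ultimately show ?thesis
      using Jnz qpoch_inf_double[OF assms(2), of z] qpoch_inf_double[OF assms(2), of "q / z"]
      unfolding theta_j_def J(1) [symmetric] p_def [symmetric] by (simp add: power2_eq_square)
  qed

  define E where "E = (\<lambda>z. z * \<theta> (z * q) ^ 2 * H z + q / z * \<theta> z ^ 2 * H (z * q)
                            + \<theta> z ^ 2 * \<theta> (z * q) ^ 2 / J2 ^ 2)"
  have holo: "\<theta> holomorphic_on - {0}" "H holomorphic_on - {0}"
    unfolding \<theta>_def H_def using holomorphic_theta_j holomorphic_g3c_num p(2) by auto
  have holo_q: "(\<lambda>z. f (z * q)) holomorphic_on - {0}" if "f holomorphic_on - {0}" for f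
  proof -
    have "(f \<circ> (\<lambda>z. z * q)) holomorphic_on - {0}"
      by (rule holomorphic_on_compose_gen[OF _ that]) (use assms(1) in \<open>auto intro!: holomorphic_intros\<close>)
    thus ?thesis by (simp add: o_def)
  qed
  have "E holomorphic_on - {0}"
    unfolding E_def by (intro holomorphic_intros holo holo_q) (use Jnz in auto)
  \<comment> \<open>The shift exchanges the first two summands of \<open>E\<close>. The
    inhomogeneous term of \<open>H (z * p)\<close> contributes \<open>1 - 1 / z ^ 2\<close> times
    the third summand, which itself shifts to \<open>1 / z ^ 2\<close> times its old value.\<close>
  moreover have "E (z * q) = E z" if z: "z \<noteq> 0" for z
  proof -
    have zqq: "z * q * q = z * p" by (simp add: p_def power2_eq_square)
    have 1: "\<theta> (z * p) = - \<theta> z / z"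
      unfolding \<theta>_def by (rule theta_j_shift[OF p(2,1) z])
    have 2: "H (z * p) = z ^ 2 * H z + (z - 1 / z) * (\<theta> z / J2) ^ 2"
      unfolding H_def prod [symmetric] by (rule g3c_num_shift[OF p(2,1) z])
    show ?thesis
      unfolding E_def zqq 1 2 using z Jnz assms(1) by (simp add: field_simps power2_eq_square)
  qed
  ultimately have "E x = E 1"
    using multiplicatively_periodic_imp_constant[OF assms(1,2)] assms(3) by blast
  \<comment> \<open>Two of the three summands contain \<open>\<theta> 1 = 0\<close>.\<close>
  also have "E 1 = \<theta> q ^ 2 * J2"
    using theta_j_1[OF p(2)] g3c_num_1[OF p(2)] by (simp add: E_def \<theta>_def H_def J)
  also have "\<dots> = J1 ^ 4 / J2"
    using \<theta>_q Jnz by (simp add: field_simps) algebra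
  finally have E: "E x * J2 = J1 ^ 4" using Jnz by simp

  \<comment> \<open>Powers of \<open>p\<close> are even powers of \<open>q\<close>; if
    \<open>x * q\<close> were one, \<open>x\<close> would be an odd power of
    \<open>q\<close>.\<close>
  have x_p: "x \<noteq> p powi k" "x * q \<noteq> p powi k" for k
  proof -
    have p_powi: "p powi k = q powi (2 * k)"
      by (simp add: p_def power_int_mult)
    thus "x \<noteq> p powi k" using assms(4) by simp
    show "x * q \<noteq> p powi k"
    proof
      assume "x * q = p powi k"
      hence "x = q powi (2 * k - 1)"
        using assms(1) by (simp add: p_powi power_int_diff field_simps)
      thus False using assms(4) by blast
    qed
  qed
  have \<theta>nz: "\<theta> x \<noteq> 0" "\<theta> (x * q) \<noteq> 0"
    unfolding \<theta>_def using theta_j_eq_0_iff[OF p] x_p assms(1,3) by auto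
  have g: "g3c x p = H x * J2 / \<theta> x" "g3c (x * q) p = H (x * q) * J2 / \<theta> (x * q)"
    using g3c_eq[OF p(2,1)] x_p assms(1,3) by (auto simp: H_def prod)
  have "(x * \<theta> (x * q) * (H x * J2 / \<theta> x) + inverse x * q * \<theta> x * (H (x * q) * J2 / \<theta> (x * q))
          + \<theta> x * \<theta> (x * q) / J2) * (\<theta> x * \<theta> (x * q)) = E x * J2"
    unfolding E_def using \<theta>nz Jnz assms(3) by (simp add: field_simps power2_eq_square)
  hence "x * \<theta> (x * q) * g3c x p + inverse x * q * \<theta> x * g3c (x * q) p
           = J1 ^ 4 / (\<theta> x * \<theta> (x * q)) - \<theta> x * \<theta> (x * q) / J2"
    unfolding E g using \<theta>nz by (simp add: eq_divide_eq algebra_simps)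
  also have "\<dots> = J1 ^ 5 / (J2 ^ 2 * theta_j x q) - J2 * theta_j x q / J1"
    unfolding \<theta>_prod[OF assms(3)] using \<theta>nz Jnz
    by (simp add: field_simps power2_eq_square eval_nat_numeral)
  finally show ?thesis
    unfolding \<theta>_def J1_def J2_def p_def .
qed

end
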